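(* The set $$\left\{\left(\tfrac{d}{c},\,S(d,c)+S_4(d,c)\right): d,c\in\mathbf{Z},\ \gcd(d,c)=1,\ c>0\ \text{even},\ d\ \text{odd}\right\}$$ is dense in $\mathbf{R}\times2\mathbf{Z}$.
   Context: For coprime integers $d,c$ with $c>0$ the Hardy sums are $$S(d,c)=\sum_{k=1}^{c-1}(-1)^{k+1+\lfloor dk/c\rfloor},\qquad S_4(d,c)=\sum_{k=1}^{c-1}(-1)^{\lfloor dk/c\rfloor}.$$ $\mathbf{R}\times2\mathbf{Z}$ carries the product of the usual topology on $\mathbf{R}$ and the discrete topology on the even integers $2\mathbf{Z}$. *)

theory Defs
  imports "HOL-Analysis.Analysis"
begin

text \<open>The type of integers has no inverse operation, so \<open>powi\<close> is not available in it, while the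
  exponents in the Hardy sums may be negative.  The lemma below the definition identifies
  \<open>minus_one_powi\<close> with the integer power of \<open>-1\<close>.\<close>

definition minus_one_powi :: "int \<Rightarrow> int" where
  "minus_one_powi n = (if even n then 1 else - 1)"

lemma of_int_minus_one_powi: "real_of_int (minus_one_powi n) = (- 1) powi n"
  by (simp add: minus_one_powi_def power_int_minus_left)

text \<open>The Hardy sums are meant for coprime \<open>d\<close>, \<open>c\<close> with \<open>c > 0\<close>.\<close>

definition hardy_S :: "int \<Rightarrow> int \<Rightarrow> int" where
  "hardy_S d c = (\<Sum>k = 1..c - 1. minus_one_powi (k + 1 + \<lfloor>real_of_int (d * k) / real_of_int c\<rfloor>))"

definition hardy_S4 :: "int \<Rightarrow> int \<Rightarrow> int" where
  "hardy_S4 d c = (\<Sum>k = 1..c - 1. minus_one_powi \<lfloor>real_of_int (d * k) / real_of_int c\<rfloor>)"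

definition hardy_graph :: "(real \<times> int) set" where
  "hardy_graph = {(real_of_int d / real_of_int c, hardy_S d c + hardy_S4 d c) | d c.
     coprime d c \<and> c > 0 \<and> even c \<and> odd d}"

definition real_times_even_ints :: "(real \<times> int) topology" where
  "real_times_even_ints = prod_topology euclideanreal (discrete_topology {n. even n})"

text \<open>\<open>X closure_of S\<close> silently discards the part of \<open>S\<close> outside \<open>topspace X\<close>, hence the
  explicit inclusion.\<close>

definition dense_in :: "'a topology \<Rightarrow> 'a set \<Rightarrow> bool" where
  "dense_in X S \<longleftrightarrow> S \<subseteq> topspace X \<and> X closure_of S = topspace X"

end

theory Submission
  imports Defs "HOL-Real_Asymp.Real_Asymp"
begin

text \<open>Pairing the two sums leaves twice the sum \<open>T\<close> over odd \<open>k\<close>.  Besides \<open>T(d + 2c, c) = T(d, c)\<close>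
  and \<open>T(- d, c) = - T(d, c)\<close> one has \<open>T(d, c + 2d) = T(d, c) + 1\<close>: grouping the \<open>k\<close> by the value
  \<open>j = \<lfloor>dk/c\<rfloor>\<close>, each of the \<open>d\<close> groups gains exactly one element, and the
  groups count with alternating signs, starting and ending with \<open>+\<close>.  So the sets \<open>D(n)\<close> of fractions
  \<open>d/c\<close> with \<open>T(d, c) = n\<close> satisfy \<open>D(n) + 2 \<subseteq> D(n)\<close>, \<open>- D(n) \<subseteq> D(- n)\<close>, and
  \<open>x \<mapsto> x / (1 + 2x)\<close> carries \<open>D(n)\<close> into \<open>D(n + 1)\<close>.  Each \<open>D(n)\<close> is nonempty, hence unbounded,
  hence \<open>D(n + 1)\<close> accumulates at \<open>1/2\<close>.  A Euclidean algorithm built from the three maps reduces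
  every fraction with odd numerator and even denominator to \<open>1/2\<close>.\<close>

section \<open>The alternating sum over odd indices\<close>

definition odd_hardy :: "int \<Rightarrow> int \<Rightarrow> int" where
  "odd_hardy d c = (\<Sum>k | k \<in> {1..c - 1} \<and> odd k. minus_one_powi (d * k div c))"

text \<open>For odd \<open>k\<close> the two signs agree; for even \<open>k\<close> they
  cancel.\<close>

lemma hardy_S_plus_S4: "hardy_S d c + hardy_S4 d c = 2 * odd_hardy d c"
proof -
  have "hardy_S d c + hardy_S4 d c =
      (\<Sum>k = 1..c - 1. if odd k then 2 * minus_one_powi (d * k div c) else 0)"
    unfolding hardy_S_def hardy_S4_def sum.distrib[symmetric] floor_divide_of_int_eq
    by (intro sum.cong) (auto simp: minus_one_powi_def)
  also have "\<dots> = (\<Sum>k | k \<in> {1..c - 1} \<and> odd k. 2 * minus_one_powi (d * k div c))"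
    by (subst sum.inter_filter) auto
  finally show ?thesis
    by (simp add: odd_hardy_def sum_distrib_left)
qed

text \<open>Each quotient changes by the even number \<open>2 * m * k\<close>.\<close>

lemma odd_hardy_periodic:
  assumes "c > 0"
  shows "odd_hardy (d + 2 * c * m) c = odd_hardy d c"
proof -
  have "minus_one_powi ((d + 2 * c * m) * k div c) = minus_one_powi (d * k div c)" for k
  proof -
    have "(d + 2 * c * m) * k = d * k + c * (2 * m * k)"
      by (simp add: algebra_simps)
    then have "(d + 2 * c * m) * k div c = d * k div c + 2 * m * k"
      using assms by simp
    then show ?thesis
      by (simp add: minus_one_powi_def)
  qed
  then show ?thesis
    by (simp add: odd_hardy_def)
qed

text \<open>The even \<open>c\<close> cannot divide the odd \<open>d * k\<close>, so negation turns
  each quotient \<open>q\<close> into \<open>- q - 1\<close>, of opposite parity.\<close>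

lemma odd_hardy_minus:
  assumes "c > 0" "even c" "odd d"
  shows "odd_hardy (- d) c = - odd_hardy d c"
proof -
  have "minus_one_powi (- d * k div c) = - minus_one_powi (d * k div c)" if "odd k" for k
  proof -
    have "\<not> c dvd d * k"
      using assms that by (meson dvd_trans even_mult_iff)
    then have "- d * k div c = - (d * k div c) - 1"
      by (simp add: zdiv_zminus1_eq_if mod_eq_0_iff_dvd assms(1) less_imp_neq[symmetric])
    then show ?thesis
      by (simp add: minus_one_powi_def)
  qed
  then show ?thesis
    by (simp add: odd_hardy_def sum_negf[symmetric])
qed

text \<open>\<open>(j * c + d) div (2 * d)\<close> is the number of odd \<open>k\<close> in the interval from \<open>0\<close> to \<open>j * c / d\<close>.
  Unlike \<open>odd_hardy\<close>, this expression makes sense for \<open>c\<close> of either sign.\<close>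

definition grouped_hardy :: "int \<Rightarrow> int \<Rightarrow> int" where
  "grouped_hardy d c = (\<Sum>j = 0..d - 1. minus_one_powi j *
     (((j + 1) * c + d) div (2 * d) - (j * c + d) div (2 * d)))"

lemma int_le_div_iff:
  fixes m n q :: int
  assumes "q > 0"
  shows "m \<le> n div q \<longleftrightarrow> m * q \<le> n"
proof
  assume "m \<le> n div q"
  then have "m * q \<le> n div q * q"
    using assms by (intro mult_right_mono) auto
  also have "\<dots> \<le> n"
    using assms by (simp add: minus_mod_eq_div_mult [symmetric])
  finally show "m * q \<le> n" .
next
  assume "m * q \<le> n"
  then have "m * q div q \<le> n div q"
    using assms by (intro zdiv_mono1)
  with assms show "m \<le> n div q"
    by simp
qed

lemma card_odd_less:
  fixes d a :: int
  assumes "d > 0" "odd d" "even a" "a \<ge> 0"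
  shows "finite {k. k \<ge> 1 \<and> odd k \<and> d * k < a}"
    and "int (card {k. k \<ge> 1 \<and> odd k \<and> d * k < a}) = (a + d) div (2 * d)"
proof -
  define q where "q = (a + d) div (2 * d)"
  have "q \<ge> 0"
    using assms by (simp add: q_def pos_imp_zdiv_nonneg_iff)
  have less_iff: "d * (2 * m + 1) < a \<longleftrightarrow> m < q" for m
  proof -
    \<comment> \<open>An odd number differs from an even one, so strict and weak inequality agree
      here.\<close>
    have "d * (2 * m + 1) \<noteq> a"
      using assms by (metis even_mult_iff even_plus_one_iff dvd_triv_left)
    then have "d * (2 * m + 1) < a \<longleftrightarrow> (m + 1) * (2 * d) \<le> a + d"
      by (auto simp: algebra_simps)
    also have "\<dots> \<longleftrightarrow> m + 1 \<le> q"
      unfolding q_def using assms by (simp add: int_le_div_iff)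
    finally show ?thesis
      by auto
  qed
  have eq: "{k. k \<ge> 1 \<and> odd k \<and> d * k < a} = (\<lambda>m. 2 * m + 1) ` {0..<q}"
  proof (intro set_eqI iffI)
    fix k assume "k \<in> {k. k \<ge> 1 \<and> odd k \<and> d * k < a}"
    then show "k \<in> (\<lambda>m. 2 * m + 1) ` {0..<q}"
      using less_iff by (auto elim!: oddE)
  qed (auto simp: less_iff)
  show "finite {k. k \<ge> 1 \<and> odd k \<and> d * k < a}"
    by (simp add: eq)
  have "card ((\<lambda>m. 2 * m + 1) ` {0..<q}) = card {0..<q}"
    by (intro card_image) (auto simp: inj_on_def)
  then show "int (card {k. k \<ge> 1 \<and> odd k \<and> d * k < a}) = (a + d) div (2 * d)"
    using \<open>q \<ge> 0\<close> by (simp add: eq flip: q_def)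
qed

text \<open>The odd \<open>k\<close> with quotient \<open>j\<close> form
  \<open>N (j + 1) - N j\<close>, whose size is a difference of two counts given by
  \<open>card_odd_less\<close>.\<close>

lemma odd_hardy_eq_grouped:
  assumes "c > 0" "even c" "d > 0" "odd d"
  shows "odd_hardy d c = grouped_hardy d c"
proof -
  define K where "K = {k. k \<in> {1..c - 1} \<and> odd k}"
  define N where "N j = {k. k \<ge> 1 \<and> odd k \<and> d * k < j * c}" for j
  have card_N: "finite (N j)" "int (card (N j)) = (j * c + d) div (2 * d)" if "j \<ge> 0" for j
    using card_odd_less[of d "j * c"] assms that by (simp_all add: N_def)
  have "finite K"
    unfolding K_def by (rule finite_subset[of _ "{1..c - 1}"]) auto
  moreover have "(\<lambda>k. d * k div c) ` K \<subseteq> {0..d - 1}"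
  proof
    fix j assume "j \<in> (\<lambda>k. d * k div c) ` K"
    then obtain k where k: "j = d * k div c" "1 \<le> k" "k < c"
      by (auto simp: K_def)
    then have "d * k div c < d"
      using assms int_le_div_iff[of c d "d * k"] by (simp add: not_le[symmetric])
    with k assms show "j \<in> {0..d - 1}"
      by (simp add: pos_imp_zdiv_nonneg_iff)
  qed
  ultimately have "odd_hardy d c =
      (\<Sum>j = 0..d - 1. \<Sum>k | k \<in> K \<and> d * k div c = j. minus_one_powi (d * k div c))"
    unfolding odd_hardy_def K_def by (intro sum.group[symmetric]) auto
  also have "\<dots> = grouped_hardy d c"
    unfolding grouped_hardy_def
  proof (intro sum.cong refl)
    fix j assume j: "j \<in> {0..d - 1}"
    have N_mono: "N j \<subseteq> N (j + 1)"
      using assms by (auto simp: N_def algebra_simps)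
    have "{k. k \<in> K \<and> d * k div c = j} = N (j + 1) - N j"
    proof (intro set_eqI)
      fix k
      have div_iff: "d * k div c = j \<longleftrightarrow> j * c \<le> d * k \<and> d * k < (j + 1) * c"
        using assms int_le_div_iff[of c j "d * k"] int_le_div_iff[of c "j + 1" "d * k"]
        by auto
      \<comment> \<open>The upper bound in \<open>K\<close> comes for free from
        \<open>j \<le> d - 1\<close>.\<close>
      have "k < c" if "d * k < (j + 1) * c"
      proof -
        have "(j + 1) * c \<le> d * c"
          using j assms by (intro mult_right_mono) auto
        then show ?thesis
          using that assms by (metis less_le_trans mult_less_cancel_left_pos)
      qed
      then show "k \<in> {k. k \<in> K \<and> d * k div c = j} \<longleftrightarrow> k \<in> N (j + 1) - N j"
        by (auto simp: K_def N_def div_iff)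
    qed
    moreover have "int (card (N (j + 1) - N j)) = int (card (N (j + 1))) - int (card (N j))"
      using j N_mono card_N[of j] card_N[of "j + 1"]
      by (simp add: card_Diff_subset card_mono)
    ultimately have "int (card {k. k \<in> K \<and> d * k div c = j}) =
        ((j + 1) * c + d) div (2 * d) - (j * c + d) div (2 * d)"
      using j card_N[of j] card_N[of "j + 1"] by simp
    then show "(\<Sum>k | k \<in> K \<and> d * k div c = j. minus_one_powi (d * k div c)) =
        minus_one_powi j * (((j + 1) * c + d) div (2 * d) - (j * c + d) div (2 * d))"
      by simp
  qed
  finally show ?thesis .
qed

section \<open>Shift and reflection of the grouped sum in its second argument\<close>

lemma sum_minus_one_powi: "(\<Sum>j = 0..2 * int n. minus_one_powi j) = 1"
proof (induction n)
  case (Suc n)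
  have "{0..2 * int (Suc n)} = insert (2 * int n + 2) (insert (2 * int n + 1) {0..2 * int n})"
    by auto
  with Suc show ?case
    by (simp add: minus_one_powi_def)
qed (simp add: minus_one_powi_def)

text \<open>The \<open>j\<close>-th count grows by \<open>j\<close>, so every difference grows by 1;
  as \<open>d\<close> is odd, these alternating gains add up to 1.\<close>

lemma grouped_hardy_shift:
  assumes "d > 0" "odd d"
  shows "grouped_hardy d (c + 2 * d) = grouped_hardy d c + 1"
proof -
  have shift: "(j * (c + 2 * d) + d) div (2 * d) = (j * c + d) div (2 * d) + j" for j
  proof -
    have "j * (c + 2 * d) + d = (j * c + d) + j * (2 * d)"
      by (simp add: algebra_simps)
    then show ?thesis
      using assms by (metis add.commute div_mult_self1 less_irrefl mult_eq_0_iff zero_neq_numeral)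
  qed
  obtain k where "d = 2 * k + 1"
    using assms by (auto elim: oddE)
  with assms have "d - 1 = 2 * int (nat k)"
    by simp
  then have "(\<Sum>j = 0..d - 1. minus_one_powi j) = 1"
    by (simp only: sum_minus_one_powi)
  moreover have "minus_one_powi j * (a + (j + 1) - (b + j)) =
      minus_one_powi j * (a - b) + minus_one_powi j" for j a b
    by (simp add: algebra_simps)
  ultimately show ?thesis
    unfolding grouped_hardy_def shift by (simp only: sum.distrib)
qed

text \<open>\<open>j * c + d\<close> is odd, so \<open>2 * d\<close> does not divide it and negating
  it costs an extra 1 in the quotient; passing from \<open>- d\<close> to \<open>+ d\<close> in the
  numerator restores that 1.\<close>

lemma grouped_hardy_minus:
  assumes "d > 0" "odd d" "even c"
  shows "grouped_hardy d (- c) = - grouped_hardy d c"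
proof -
  have neg: "(j * (- c) + d) div (2 * d) = - ((j * c + d) div (2 * d))" for j
  proof -
    have "\<not> 2 * d dvd j * c + d"
      using assms by (metis dvd_mult_left even_add even_mult_iff)
    then have "(- (j * c + d)) div (2 * d) = - ((j * c + d) div (2 * d)) - 1"
      using assms by (subst zdiv_zminus1_eq_if) (auto simp: mod_eq_0_iff_dvd)
    moreover have "j * (- c) + d = - (j * c + d) + 1 * (2 * d)"
      by simp
    then have "(j * (- c) + d) div (2 * d) = (- (j * c + d)) div (2 * d) + 1"
      using assms by (metis add.commute div_mult_self1 less_irrefl mult_eq_0_iff zero_neq_numeral)
    ultimately show ?thesis
      by simp
  qed
  show ?thesis
    unfolding grouped_hardy_def neg by (simp add: sum_negf[symmetric] algebra_simps)
qed

text \<open>The factor \<open>sgn\<close> keeps the denominator of \<open>d / (c + 2 * d)\<close>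
  positive. Negative \<open>d\<close> is handled by reflection to \<open>e = - d\<close>.\<close>

lemma odd_hardy_shift:
  assumes "c > 0" "even c" "odd d" "c + 2 * d \<noteq> 0"
  shows "odd_hardy (sgn (c + 2 * d) * d) \<bar>c + 2 * d\<bar> = odd_hardy d c + 1"
proof (cases "d > 0")
  case True
  with assms show ?thesis
    by (simp add: odd_hardy_eq_grouped grouped_hardy_shift)
next
  case False
  define e where "e = - d"
  have e: "e > 0" "odd e" "d = - e"
    using False assms by (auto simp: e_def order.strict_iff_order)
  have old: "odd_hardy d c = - grouped_hardy e c"
    using assms e by (simp add: odd_hardy_minus odd_hardy_eq_grouped)
  show ?thesis
  proof (cases "c - 2 * e > 0")
    case True
    \<comment> \<open>The shift leads from \<open>c - 2 * e\<close> back up to \<open>c\<close>; the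
      minus sign of the reflection turns the loss into a gain.\<close>
    then have "odd_hardy (- e) (c - 2 * e) = - grouped_hardy e (c - 2 * e)"
      using assms e by (simp add: odd_hardy_minus odd_hardy_eq_grouped)
    with True old e grouped_hardy_shift[of e "c - 2 * e"] show ?thesis
      by simp
  next
    case False
    then have "c - 2 * e < 0"
      using assms e by simp
    \<comment> \<open>The shift now starts at the negative argument \<open>- c\<close>, where
      \<open>grouped_hardy\<close> still obeys its reflection rule.\<close>
    then have "odd_hardy e (2 * e - c) = grouped_hardy e (- c + 2 * e)"
      using assms e by (simp add: odd_hardy_eq_grouped)
    also have "\<dots> = odd_hardy d c + 1"
      using assms e old by (simp add: grouped_hardy_shift grouped_hardy_minus del: uminus_add_conv_diff)
    finally show ?thesis
      using \<open>c - 2 * e < 0\<close> e by simp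
  qed
qed

section \<open>Density of the level sets\<close>

text \<open>The slice of \<open>hardy_graph\<close> at height \<open>2 * n\<close>.\<close>

definition hardy_level :: "int \<Rightarrow> real set" where
  "hardy_level n = {real_of_int d / real_of_int c | d c.
     coprime d c \<and> c > 0 \<and> even c \<and> odd d \<and> odd_hardy d c = n}"

lemma hardy_levelI:
  assumes "coprime d c" "c > 0" "even c" "odd d" "odd_hardy d c = n"
    and "x = real_of_int d / real_of_int c"
  shows "x \<in> hardy_level n"
  using assms unfolding hardy_level_def by blast

lemma hardy_levelE:
  assumes "x \<in> hardy_level n"
  obtains d c where "coprime d c" "c > 0" "even c" "odd d" "odd_hardy d c = n"
    "x = real_of_int d / real_of_int c"
  using assms unfolding hardy_level_def by blast

lemma hardy_level_uminus:
  assumes "x \<in> hardy_level n"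
  shows "- x \<in> hardy_level (- n)"
  using assms
proof (rule hardy_levelE)
  fix d c assume "coprime d c" "c > 0" "even c" "odd d" "odd_hardy d c = n"
    "x = real_of_int d / real_of_int c"
  then show ?thesis
    by (intro hardy_levelI[of "- d" c]) (auto simp: odd_hardy_minus)
qed

lemma hardy_level_translate:
  assumes "x \<in> hardy_level n"
  shows "x + 2 * real_of_int m \<in> hardy_level n"
  using assms
proof (rule hardy_levelE)
  fix d c assume *: "coprime d c" "c > 0" "even c" "odd d" "odd_hardy d c = n"
    "x = real_of_int d / real_of_int c"
  have "coprime (d + 2 * c * m) c"
  proof -
    have "gcd (2 * m * c + d) c = gcd d c"
      using gcd_add_mult[of c "2 * m" d] by (simp only: gcd.commute[of _ c])
    with * show ?thesis
      by (simp add: coprime_iff_gcd_eq_1 algebra_simps)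
  qed
  with * show ?thesis
    by (intro hardy_levelI[of "d + 2 * c * m" c]) (auto simp: odd_hardy_periodic add_divide_distrib)
qed

text \<open>For \<open>x = d / c\<close> the image is \<open>d / (c + 2 * d)\<close>, so this is
  \<open>odd_hardy_shift\<close> read on fractions.\<close>

lemma hardy_level_moebius:
  assumes "x \<in> hardy_level n" "1 + 2 * x \<noteq> 0"
  shows "x / (1 + 2 * x) \<in> hardy_level (n + 1)"
  using assms(1)
proof (rule hardy_levelE)
  fix d c assume *: "coprime d c" "c > 0" "even c" "odd d" "odd_hardy d c = n"
    "x = real_of_int d / real_of_int c"
  define s where "s = c + 2 * d"
  have eq: "1 + 2 * x = real_of_int s / real_of_int c"
    using * by (simp add: s_def field_simps)
  with assms have "s \<noteq> 0"
    by auto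
  have "coprime d s"
    using *(1) unfolding s_def
    by (metis add.commute coprime_iff_gcd_eq_1 gcd_add_mult)
  then have "coprime (sgn s * d) \<bar>s\<bar>"
    using \<open>s \<noteq> 0\<close> by (simp add: sgn_if)
  moreover have "x / (1 + 2 * x) = real_of_int (sgn s * d) / real_of_int \<bar>s\<bar>"
    unfolding eq using * \<open>s \<noteq> 0\<close> by (simp add: sgn_if abs_if)
  ultimately show ?thesis
    using * \<open>s \<noteq> 0\<close> odd_hardy_shift[of c d]
    by (intro hardy_levelI[of "sgn s * d" "\<bar>s\<bar>"]) (auto simp: s_def sgn_if)
qed

text \<open>For \<open>1 / (2 * m)\<close> with \<open>m > 0\<close> all \<open>m\<close> odd
  indices have quotient 0; reflection then gives the negative levels.\<close>

lemma hardy_level_nonempty: "hardy_level n \<noteq> {}"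
proof -
  have pos: "1 / (2 * real_of_int m) \<in> hardy_level m" if "m > 0" for m
  proof -
    have "odd_hardy 1 (2 * m) = m"
      using that by (simp add: odd_hardy_eq_grouped grouped_hardy_def minus_one_powi_def)
    with that show ?thesis
      by (intro hardy_levelI[of 1 "2 * m"]) auto
  qed
  \<comment> \<open>Level 0 is witnessed by \<open>3 / 8\<close>: the indices 1, 3, 5, 7 have
    quotients 0, 1, 1, 2, and the signs cancel.\<close>
  have "{0..2} = {0, 1, 2::int}"
    by auto
  then have "odd_hardy 3 8 = 0"
    by (simp add: odd_hardy_eq_grouped grouped_hardy_def minus_one_powi_def)
  moreover have "coprime (3::int) 8"
  proof (rule coprimeI)
    fix e :: int assume "e dvd 3" "e dvd 8"
    then have "e dvd 3 * 3 - 8"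
      by (intro dvd_diff dvd_mult)
    then show "e dvd 1"
      by simp
  qed
  ultimately have zero: "3 / 8 \<in> hardy_level 0"
    by (intro hardy_levelI[of 3 8]) auto
  show ?thesis
  proof (cases n "0 :: int" rule: linorder_cases)
    case less
    then show ?thesis
      using hardy_level_uminus[OF pos[of "- n"]] by auto
  qed (use zero pos[of n] in auto)
qed

lemma half_in_closure_hardy_level: "1 / 2 \<in> closure (hardy_level n)"
proof -
  obtain x where x: "x \<in> hardy_level (n - 1)"
    using hardy_level_nonempty by blast
  define u where "u i = x + 2 * real i" for i
  have "filterlim u at_top sequentially"
    unfolding u_def
    by (intro filterlim_tendsto_add_at_top[OF tendsto_const]
        filterlim_tendsto_pos_mult_at_top[OF tendsto_const] filterlim_real_sequentially) simp
  then have "eventually (\<lambda>i. u i > 0) sequentially"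
    by (simp add: filterlim_at_top_dense)
  moreover have "u i / (1 + 2 * u i) \<in> hardy_level n" if "u i > 0" for i
    using hardy_level_moebius[of "u i" "n - 1"] hardy_level_translate[OF x, of "int i"] that
    by (simp add: u_def)
  ultimately have "eventually (\<lambda>i. u i / (1 + 2 * u i) \<in> closure (hardy_level n)) sequentially"
    using closure_subset by (force elim: eventually_mono)
  moreover have "((\<lambda>y::real. y / (1 + 2 * y)) \<longlongrightarrow> 1 / 2) at_top"
    by real_asymp
  then have "(\<lambda>i. u i / (1 + 2 * u i)) \<longlonglongrightarrow> 1 / 2"
    using \<open>filterlim u at_top sequentially\<close> by (rule filterlim_compose)
  ultimately show ?thesis
    by (intro Lim_in_closed_set[OF closed_closure]) auto
qed

section \<open>Closures of the level sets under the three maps\<close>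

lemma closure_hardy_level_uminus:
  assumes "x \<in> closure (hardy_level n)"
  shows "- x \<in> closure (hardy_level (- n))"
proof -
  have "uminus ` closure (hardy_level n) \<subseteq> closure (hardy_level (- n))"
    by (intro image_closure_subset continuous_intros closed_closure)
      (auto intro: hardy_level_uminus closure_subset[THEN subsetD])
  with assms show ?thesis
    by blast
qed

lemma closure_hardy_level_translate:
  assumes "x \<in> closure (hardy_level n)"
  shows "x + 2 * real_of_int m \<in> closure (hardy_level n)"
proof -
  have "(\<lambda>x. x + 2 * real_of_int m) ` closure (hardy_level n) \<subseteq> closure (hardy_level n)"
    by (intro image_closure_subset continuous_intros closed_closure)
      (auto intro: hardy_level_translate closure_subset[THEN subsetD])
  with assms show ?thesis
    by blast
qed

text \<open>The map has a pole at \<open>- 1 / 2\<close>, so the argument uses a sequence, which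
  eventually avoids the pole.\<close>

lemma closure_hardy_level_moebius:
  assumes "x \<in> closure (hardy_level n)" "1 + 2 * x \<noteq> 0"
  shows "x / (1 + 2 * x) \<in> closure (hardy_level (n + 1))"
proof -
  obtain u where u: "\<And>i. u i \<in> hardy_level n" "u \<longlonglongrightarrow> x"
    using assms by (auto simp: closure_sequential)
  have "(\<lambda>i. 1 + 2 * u i) \<longlonglongrightarrow> 1 + 2 * x"
    by (intro tendsto_intros u)
  then have "eventually (\<lambda>i. 1 + 2 * u i \<noteq> 0) sequentially"
    using assms(2) by (rule tendsto_imp_eventually_ne)
  then have "eventually (\<lambda>i. u i / (1 + 2 * u i) \<in> closure (hardy_level (n + 1))) sequentially"
    using hardy_level_moebius u closure_subset by (force elim: eventually_mono)
  moreover have "(\<lambda>i. u i / (1 + 2 * u i)) \<longlonglongrightarrow> x / (1 + 2 * x)"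
    using assms by (intro tendsto_intros u)
  ultimately show ?thesis
    by (intro Lim_in_closed_set[OF closed_closure]) auto
qed

text \<open>Euclidean descent on \<open>c\<close>, for all levels at once: for
  \<open>0 < e < c\<close> the fraction \<open>e / c\<close> is the image of
  \<open>e / (c - 2 * e)\<close>, and \<open>\<bar>c - 2 * e\<bar> < c\<close>. It stops at
  \<open>1 / 2\<close>.\<close>

lemma odd_over_even_in_closure_hardy_level:
  assumes "c > 0" "even c" "odd d"
  shows "real_of_int d / real_of_int c \<in> closure (hardy_level n)"
  using assms
proof (induction "nat c" arbitrary: c d n rule: less_induct)
  case less
  have small: "real_of_int e / real_of_int c \<in> closure (hardy_level n)"
    if e: "0 < e" "e < c" "odd e" for e n
  proof (cases "c = 2 * e")
    case True
    then show ?thesis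
      using half_in_closure_hardy_level e by simp
  next
    case False
    define s where "s = c - 2 * e"
    define y where "y = real_of_int e / real_of_int s"
    have s: "s \<noteq> 0" "nat \<bar>s\<bar> < nat c" "even s"
      using False e less.prems by (auto simp: s_def)
    have "y = real_of_int (sgn s * e) / real_of_int \<bar>s\<bar>"
      by (simp add: y_def sgn_if abs_if)
    then have "y \<in> closure (hardy_level (n - 1))"
      using less.hyps[of "\<bar>s\<bar>" "sgn s * e" "n - 1"] s e by (simp add: sgn_if)
    moreover have c: "1 + 2 * y = real_of_int c / real_of_int s"
      using s by (simp add: y_def s_def field_simps)
    moreover have "y / (1 + 2 * y) = real_of_int e / real_of_int c"
      unfolding c using s by (simp add: y_def)
    ultimately show ?thesis
      using closure_hardy_level_moebius[of y "n - 1"] s less.prems by simp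
  qed
  \<comment> \<open>Only even translations are available, hence the modulus
    \<open>2 * c\<close>.\<close>
  define r where "r = d mod (2 * c)"
  have r: "0 \<le> r" "r < 2 * c" "odd r" "d = r + 2 * c * (d div (2 * c))"
    using less.prems by (auto simp: r_def mod2_eq_if dvd_mod_iff)
  have "real_of_int r / real_of_int c \<in> closure (hardy_level n)"
  proof (cases "r < c")
    case True
    with r show ?thesis
      by (intro small) (auto simp: order.strict_iff_order)
  next
    case False
    \<comment> \<open>By parity \<open>r \<noteq> c\<close>, so \<open>2 * c - r\<close> lies
      strictly between 0 and \<open>c\<close>; reflection and translation by 2 lead back to
      \<open>r / c\<close>.\<close>
    then have "real_of_int (2 * c - r) / real_of_int c \<in> closure (hardy_level (- n))"
      using r less.prems by (intro small) (auto simp: order.strict_iff_order)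
    from closure_hardy_level_translate[OF closure_hardy_level_uminus[OF this], of 1]
    show ?thesis
      using less.prems by (simp add: field_simps)
  qed
  from closure_hardy_level_translate[OF this, of "d div (2 * c)"]
  have "real_of_int r / real_of_int c + 2 * real_of_int (d div (2 * c)) \<in> closure (hardy_level n)" .
  moreover have "real_of_int d = real_of_int r + 2 * real_of_int c * real_of_int (d div (2 * c))"
    by (subst r(4)) simp
  ultimately show ?case
    using less.prems by (simp add: add_divide_distrib)
qed

lemma closure_hardy_level: "closure (hardy_level n) = UNIV"
proof -
  have "x \<in> closure (hardy_level n)" for x
  proof -
    \<comment> \<open>These fractions may be unreduced, which the preceding lemma allows.\<close>
    define u where "u i = real_of_int (2 * \<lfloor>x * real (Suc i)\<rfloor> + 1) / real_of_int (2 * int (Suc i))"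
      for i
    have "u i \<in> closure (hardy_level n)" for i
      unfolding u_def by (intro odd_over_even_in_closure_hardy_level) auto
    moreover have "u \<longlonglongrightarrow> x"
    proof (rule LIM_zero_cancel, rule Lim_null_comparison)
      have "\<bar>u i - x\<bar> \<le> inverse (real (Suc i))" for i
      proof -
        have "u i - x = (real_of_int \<lfloor>x * real (Suc i)\<rfloor> + 1 / 2 - x * real (Suc i)) / real (Suc i)"
          by (simp add: u_def field_simps)
        moreover have "\<bar>real_of_int \<lfloor>x * real (Suc i)\<rfloor> + 1 / 2 - x * real (Suc i)\<bar> \<le> 1"
          by linarith
        ultimately show ?thesis
          by (simp add: divide_simps del: of_nat_Suc)
      qed
      then show "eventually (\<lambda>i. norm (u i - x) \<le> inverse (real (Suc i))) sequentially"
        by simp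
      show "(\<lambda>i. inverse (real (Suc i))) \<longlonglongrightarrow> 0"
        by (rule LIMSEQ_inverse_real_of_nat)
    qed
    ultimately show ?thesis
      using closed_sequentially[OF closed_closure] by blast
  qed
  then show ?thesis
    by blast
qed

theorem theorem1p4:
  shows "dense_in real_times_even_ints hardy_graph"
proof -
  have topspace: "topspace real_times_even_ints = UNIV \<times> {n. even n}"
    by (simp add: real_times_even_ints_def)
  have "real_times_even_ints closure_of hardy_graph = topspace real_times_even_ints"
  proof (intro equalityI subsetI closure_of_subset_topspace[THEN subsetD])
    fix p assume "p \<in> topspace real_times_even_ints"
    then have "even (snd p)"
      by (auto simp: topspace)
    then obtain n where "snd p = 2 * n"
      by (rule evenE)
    then obtain x where p: "p = (x, 2 * n)"
      by (metis prod.collapse)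
    have "\<exists>q. q \<in> hardy_graph \<and> q \<in> W"
      if W: "p \<in> W" "openin real_times_even_ints W" for W
    proof -
      \<comment> \<open>A box around \<open>(x, 2 * n)\<close> contains
        \<open>U \<times> {2 * n}\<close>, so density of level \<open>n\<close> suffices.\<close>
      obtain U V where "openin euclideanreal U" and UV: "x \<in> U" "2 * n \<in> V" "U \<times> V \<subseteq> W"
        using W unfolding real_times_even_ints_def openin_prod_topology_alt p by meson
      then have "open U"
        by simp
      have "x \<in> closure (hardy_level n)"
        by (simp add: closure_hardy_level)
      with \<open>open U\<close> \<open>x \<in> U\<close> obtain y where "y \<in> hardy_level n" "y \<in> U"
        using closure_iff_nhds_not_empty[of x "hardy_level n"] by blast
      then have "(y, 2 * n) \<in> hardy_graph"
        by (auto simp: hardy_graph_def hardy_S_plus_S4 elim!: hardy_levelE)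
      with UV \<open>y \<in> U\<close> show ?thesis
        by blast
    qed
    with \<open>p \<in> topspace real_times_even_ints\<close>
    show "p \<in> real_times_even_ints closure_of hardy_graph"
      by (auto simp: in_closure_of)
  qed auto
  moreover have "hardy_graph \<subseteq> topspace real_times_even_ints"
    by (auto simp: topspace hardy_graph_def hardy_S_plus_S4)
  ultimately show ?thesis
    by (simp add: dense_in_def)
qed

end
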